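(* Let $(X,r)$, $r(x,y)=(\lambda_x(y),\rho_y(x))$, be a quasi left non-degenerate solution such that, for all $x,y\in X$, $$\lambda^0_{\lambda_x(y)}=\lambda^0_x\lambda^0_y,\qquad \rho_y(x)=\lambda^0_{\lambda_x(y)}\rho_{\lambda^0_x(y)}(x),\qquad \lambda^0_x\rho_y=\rho_y\lambda^0_x .$$ Set $x\triangleright_r y:=\lambda_x\rho_{\lambda^-_y(x)}(y)$ for all $x,y\in X$. Then the structure $(X,\triangleright_r)$ is a shelf.
   Context: Juxtaposition of maps denotes composition, $(fg)(x)=f(g(x))$. For a map $f:X\to X$, a relative inverse of $f$ is a map $f^-:X\to X$ with $ff^-f=f$, $f^-ff^-=f^-$, $ff^-=f^-f$; it is unique if it exists, and $f^0:=ff^-=f^-f$. A solution is a pair $(X,r)$ with $r:X\times X\to X\times X$ satisfying $(r\times\mathrm{id}_X)(\mathrm{id}_X\times r)(r\times\mathrm{id}_X)=(\mathrm{id}_X\times r)(r\times\mathrm{id}_X)(\mathrm{id}_X\times r)$; write $r(x,y)=(\lambda_x(y),\rho_y(x))$. It is quasi left non-degenerate if every $\lambda_x$ has a relative inverse $\lambda_x^-$ and $\lambda_x^0\lambda_y=\lambda_y\lambda_x^0$ for all $x,y\in X$, where $\lambda_x^0=\lambda_x\lambda_x^-=\lambda_x^-\lambda_x$. A (left) shelf $(X,\triangleright)$ is a set $X$ with a binary operation such that $x\triangleright(y\triangleright z)=(x\triangleright y)\triangleright(x\triangleright z)$ for all $x,y,z\in X$. *)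

theory Defs
  imports Main
begin

text \<open>The underlying set \<open>X\<close> of a solution or a shelf is the type \<open>'a\<close>.\<close>

definition is_relative_inverse :: "('a \<Rightarrow> 'a) \<Rightarrow> ('a \<Rightarrow> 'a) \<Rightarrow> bool" where
  "is_relative_inverse f g \<longleftrightarrow> f \<circ> g \<circ> f = f \<and> g \<circ> f \<circ> g = g \<and> f \<circ> g = g \<circ> f"

definition has_relative_inverse :: "('a \<Rightarrow> 'a) \<Rightarrow> bool" where
  "has_relative_inverse f \<longleftrightarrow> (\<exists>g. is_relative_inverse f g)"

text \<open>Unspecified if \<open>f\<close> has no relative inverse.\<close>

definition rel_inv :: "('a \<Rightarrow> 'a) \<Rightarrow> ('a \<Rightarrow> 'a)" where
  "rel_inv f = (THE g. is_relative_inverse f g)"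

definition rel_idem :: "('a \<Rightarrow> 'a) \<Rightarrow> ('a \<Rightarrow> 'a)" where
  "rel_idem f = f \<circ> rel_inv f"

lemma is_relative_inverse_unique:
  assumes "is_relative_inverse f g" and "is_relative_inverse f h"
  shows "g = h"
proof
  fix x
  have g: "f (g (f y)) = f y" "g (f (g y)) = g y" "f (g y) = g (f y)" for y
    using assms(1) unfolding is_relative_inverse_def by (auto simp: fun_eq_iff)
  have h: "f (h (f y)) = f y" "h (f (h y)) = h y" "f (h y) = h (f y)" for y
    using assms(2) unfolding is_relative_inverse_def by (auto simp: fun_eq_iff)
  have e: "f (g y) = f (h y)" for y
    by (metis g(1,3) h(1,3))
  show "g x = h x"
    by (metis e g(2,3) h(2,3))
qed

lemma rel_inv_eqI: "is_relative_inverse f g \<Longrightarrow> rel_inv f = g"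
  unfolding rel_inv_def by (blast intro: is_relative_inverse_unique)

lemma is_relative_inverse_rel_inv:
  "has_relative_inverse f \<Longrightarrow> is_relative_inverse f (rel_inv f)"
  unfolding has_relative_inverse_def by (auto dest: rel_inv_eqI)

lemma rel_idem_eq: "has_relative_inverse f \<Longrightarrow> rel_idem f = rel_inv f \<circ> f"
  using is_relative_inverse_rel_inv
  unfolding rel_idem_def is_relative_inverse_def by blast

text \<open>\<open>r \<times> id\<close> and \<open>id \<times> r\<close> on \<open>X \<times> X \<times> X\<close>. Triples are nested to the right, so
  \<open>id \<times> r\<close> is literally \<^const>\<open>map_prod\<close>, whereas \<open>r \<times> id\<close> needs a reassociation.\<close>

definition r_times_id :: "('a \<times> 'a \<Rightarrow> 'a \<times> 'a) \<Rightarrow> 'a \<times> 'a \<times> 'a \<Rightarrow> 'a \<times> 'a \<times> 'a" where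
  "r_times_id r = (\<lambda>(x, y, z). (fst (r (x, y)), snd (r (x, y)), z))"

definition id_times_r :: "('a \<times> 'a \<Rightarrow> 'a \<times> 'a) \<Rightarrow> 'a \<times> 'a \<times> 'a \<Rightarrow> 'a \<times> 'a \<times> 'a" where
  "id_times_r r = map_prod id r"

definition is_solution :: "('a \<times> 'a \<Rightarrow> 'a \<times> 'a) \<Rightarrow> bool" where
  "is_solution r \<longleftrightarrow>
     r_times_id r \<circ> id_times_r r \<circ> r_times_id r = id_times_r r \<circ> r_times_id r \<circ> id_times_r r"

text \<open>\<open>r (x, y) = (\<lambda>\<^sub>x(y), \<rho>\<^sub>y(x))\<close>: in both \<open>lam r x\<close> and \<open>rho r y\<close> the first argument
  after \<open>r\<close> is the subscript.\<close>

definition lam :: "('a \<times> 'a \<Rightarrow> 'a \<times> 'a) \<Rightarrow> 'a \<Rightarrow> 'a \<Rightarrow> 'a" where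
  "lam r x y = fst (r (x, y))"

definition rho :: "('a \<times> 'a \<Rightarrow> 'a \<times> 'a) \<Rightarrow> 'a \<Rightarrow> 'a \<Rightarrow> 'a" where
  "rho r y x = snd (r (x, y))"

definition lam_inv :: "('a \<times> 'a \<Rightarrow> 'a \<times> 'a) \<Rightarrow> 'a \<Rightarrow> 'a \<Rightarrow> 'a" where
  "lam_inv r x = rel_inv (lam r x)"

definition lam0 :: "('a \<times> 'a \<Rightarrow> 'a \<times> 'a) \<Rightarrow> 'a \<Rightarrow> 'a \<Rightarrow> 'a" where
  "lam0 r x = rel_idem (lam r x)"

definition quasi_left_nondegenerate :: "('a \<times> 'a \<Rightarrow> 'a \<times> 'a) \<Rightarrow> bool" where
  "quasi_left_nondegenerate r \<longleftrightarrow>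
     (\<forall>x. has_relative_inverse (lam r x)) \<and>
     (\<forall>x y. lam0 r x \<circ> lam r y = lam r y \<circ> lam0 r x)"

definition is_shelf :: "('a \<Rightarrow> 'a \<Rightarrow> 'a) \<Rightarrow> bool" where
  "is_shelf tr \<longleftrightarrow> (\<forall>x y z. tr x (tr y z) = tr (tr x y) (tr x z))"

definition shelf_op :: "('a \<times> 'a \<Rightarrow> 'a \<times> 'a) \<Rightarrow> 'a \<Rightarrow> 'a \<Rightarrow> 'a" where
  "shelf_op r x y = lam r x (rho r (lam_inv r y x) y)"

end

theory Submission
  imports Defs
begin

text \<open>
  If every \<open>\<lambda>\<^sub>x\<close> is bijective, the claim is classical: \<open>(x, y) \<mapsto> (x, \<lambda>\<^sub>x(y))\<close> conjugates \<open>r\<close> to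
  \<open>(x, y) \<mapsto> (y, y \<triangleright> x)\<close>, and the Yang--Baxter equation for a map of the latter form is
  self-distributivity. In elements, \<open>\<lambda>\<^sub>z(u) \<triangleright> z = \<lambda>\<^bsub>\<lambda>\<^sub>z(u)\<^esub>(\<rho>\<^sub>u(z))\<close>; the first two
  components of the Yang--Baxter equation make every \<open>\<lambda>\<^sub>x\<close> a homomorphism for \<open>\<triangleright>\<close>, and after the
  substitution \<open>y = \<lambda>\<^sub>z(a)\<close>, \<open>x = \<lambda>\<^sub>z(\<lambda>\<^sub>a(b))\<close> the third one becomes the shelf law. This is the
  content of \<open>left_nondegenerate_on\<close>.

  The general case is reduced to this one by localising at idempotents. Under the hypotheses the
  maps \<open>\<lambda>\<^sup>0\<^sub>x\<close> are commuting idempotents which commute with all \<open>\<lambda>\<^sub>y\<close>, \<open>\<lambda>\<^sup>-\<^sub>y\<close> and \<open>\<rho>\<^sub>y\<close>, and acting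
  with one of them on a subscript is the same as acting on the value:
  \<open>\<lambda>\<^bsub>\<lambda>\<^sup>0\<^sub>x(y)\<^esub> = \<lambda>\<^sup>0\<^sub>x\<lambda>\<^sub>y\<close> and \<open>\<lambda>\<^sup>0\<^sub>x\<rho>\<^bsub>\<lambda>\<^sup>0\<^sub>x(y)\<^esub> = \<lambda>\<^sup>0\<^sub>x\<rho>\<^sub>y\<close>. So each \<open>\<lambda>\<^sup>0\<^sub>x\<close> is an endomorphism of
  \<open>\<triangleright>\<close> (\<open>lam0_shelf_op\<close>). Given \<open>x\<close>, \<open>y\<close>, \<open>z\<close>, put \<open>E = \<lambda>\<^sup>0\<^sub>x\<lambda>\<^sup>0\<^sub>y\<lambda>\<^sup>0\<^sub>z\<close>. The points \<open>w\<close> with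
  \<open>E(w) = w\<close> and \<open>\<lambda>\<^sup>0\<^sub>w = E\<close> form a subsolution in which every \<open>\<lambda>\<^sub>w\<close> is bijective
  (\<open>left_nondegenerate_on_stratum\<close>), and \<open>E(x)\<close>, \<open>E(y)\<close>, \<open>E(z)\<close> lie in it. Both sides of the shelf
  law are fixed by \<open>E\<close>, so they equal the two sides for \<open>E(x)\<close>, \<open>E(y)\<close>, \<open>E(z)\<close>, where the bijective
  case applies.
\<close>

section \<open>Left non-degenerate solutions\<close>

text \<open>The carrier is a subset because the theory is applied to subsolutions. The map \<open>M x\<close> is the
  inverse of \<open>L x\<close> on it, and the last three assumptions are the components of the Yang--Baxter
  equation.\<close>

locale left_nondegenerate_on =
  fixes S :: "'a set" and L M R :: "'a \<Rightarrow> 'a \<Rightarrow> 'a"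
  assumes L_closed: "x \<in> S \<Longrightarrow> y \<in> S \<Longrightarrow> L x y \<in> S"
    and M_closed: "x \<in> S \<Longrightarrow> y \<in> S \<Longrightarrow> M x y \<in> S"
    and R_closed: "x \<in> S \<Longrightarrow> y \<in> S \<Longrightarrow> R x y \<in> S"
    and L_M: "x \<in> S \<Longrightarrow> y \<in> S \<Longrightarrow> L x (M x y) = y"
    and M_L: "x \<in> S \<Longrightarrow> y \<in> S \<Longrightarrow> M x (L x y) = y"
    and braid_1: "\<lbrakk>x \<in> S; y \<in> S; z \<in> S\<rbrakk> \<Longrightarrow> L x (L y z) = L (L x y) (L (R y x) z)"
    and braid_2: "\<lbrakk>x \<in> S; y \<in> S; z \<in> S\<rbrakk> \<Longrightarrow>
          L (R (L y z) x) (R z y) = R (L (R y x) z) (L x y)"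
    and braid_3: "\<lbrakk>x \<in> S; y \<in> S; z \<in> S\<rbrakk> \<Longrightarrow> R z (R y x) = R (R z y) (R (L y z) x)"
begin

definition op :: "'a \<Rightarrow> 'a \<Rightarrow> 'a" where
  "op x y = L x (R (M y x) y)"

lemmas closed = L_closed M_closed R_closed

lemma op_L_left: "z \<in> S \<Longrightarrow> u \<in> S \<Longrightarrow> op (L z u) z = L (L z u) (R u z)"
  by (simp add: op_def M_L)

lemma L_op:
  assumes "x \<in> S" "y \<in> S" "z \<in> S"
  shows "L x (op y z) = op (L x y) (L x z)"
proof -
  \<comment> \<open>The parametrisation \<open>y = \<lambda>\<^sub>z(u)\<close> brings \<open>y \<triangleright> z\<close> into the form of \<open>op_L_left\<close>.\<close>
  define u where "u = M z y"
  have u: "u \<in> S" and y: "y = L z u"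
    using assms by (auto simp: u_def closed L_M)
  have "L x (op y z) = L x (L (L z u) (R u z))"
    using assms u by (simp add: y op_L_left)
  also have "\<dots> = L (L x (L z u)) (L (R (L z u) x) (R u z))"
    using assms u by (intro braid_1) (simp_all add: closed)
  also have "\<dots> = L (L (L x z) (L (R z x) u)) (R (L (R z x) u) (L x z))"
    using assms u by (metis braid_1 braid_2)
  also have "\<dots> = op (L (L x z) (L (R z x) u)) (L x z)"
    using assms u by (simp add: op_L_left closed)
  also have "L (L x z) (L (R z x) u) = L x y"
    using assms u by (metis braid_1 y)
  finally show ?thesis .
qed

theorem op_self_distrib:
  assumes "x \<in> S" "y \<in> S" "z \<in> S"
  shows "op x (op y z) = op (op x y) (op x z)"
proof -
  define a where "a = M z y"
  have a: "a \<in> S" and y: "y = L z a"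
    using assms by (auto simp: a_def closed L_M)
  define b where "b = M a (M z x)"
  have b: "b \<in> S" and x: "x = L z (L a b)"
    using assms a by (auto simp: b_def closed L_M)
  define p where "p = R (L a b) z"
  define q where "q = R b a"
  have p: "p \<in> S" and q: "q \<in> S"
    using assms a b by (auto simp: p_def q_def closed)
  \<comment> \<open>Hence \<open>x\<close> also factors through \<open>\<lambda>\<^sub>y\<close>, which the left-hand side needs.\<close>
  have x': "x = L y (L (R a z) b)"
    using assms a b unfolding x y by (intro braid_1)
  have "op x (op y z) = op (L y (L (R a z) b)) (L y (R a z))"
    using assms a x' by (simp add: y op_L_left)
  also have "\<dots> = L y (op (L (R a z) b) (R a z))"
    using assms a b by (intro L_op [symmetric]) (simp_all add: closed)
  also have "\<dots> = L y (L (L (R a z) b) (R b (R a z)))"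
    using assms a b by (simp add: op_L_left closed)
  also have "\<dots> = L (L y (L (R a z) b)) (L (R (L (R a z) b) y) (R b (R a z)))"
    using assms a b by (intro braid_1) (simp_all add: closed)
  also have "\<dots> = L x (L (L p q) (R q p))"
    using assms a b by (simp add: y x' [unfolded y, symmetric] p_def q_def braid_2 braid_3)
  also have "\<dots> = L x (op (L p q) p)"
    using p q by (simp add: op_L_left)
  also have "\<dots> = op (L x (L p q)) (L x p)"
    using assms p q by (intro L_op) (simp_all add: closed)
  also have "L x p = op x z"
    using assms a b by (simp add: x p_def op_L_left closed)
  also have "L x (L p q) = op x y"
  proof -
    have "op x y = L z (op (L a b) a)"
      using assms a b by (simp add: x y L_op closed)
    also have "\<dots> = L z (L (L a b) (R b a))"
      using a b by (simp add: op_L_left)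
    also have "\<dots> = L x (L p q)"
      using assms a b unfolding x p_def q_def by (intro braid_1) (simp_all add: closed)
    finally show ?thesis by simp
  qed
  finally show ?thesis .
qed

end

section \<open>Relative inverses\<close>

text \<open>Put \<open>p = fg = gf\<close>. If \<open>h\<close> commutes with \<open>f\<close>, then \<open>ph = ghf = ghfp = php\<close> and
  \<open>hp = fhg = pfhg = php\<close>, so \<open>h\<close> commutes with \<open>p\<close>; hence \<open>gh = gph = ghp = ghfg = phg = hpg = hg\<close>.\<close>

lemma is_relative_inverse_comm:
  assumes fg: "is_relative_inverse f g" and h: "h \<circ> f = f \<circ> h"
  shows "h \<circ> g = g \<circ> h"
proof
  fix x
  have a: "f (g (f y)) = f y" "g (f (g y)) = g y" "f (g y) = g (f y)" for y
    using fg unfolding is_relative_inverse_def by (auto simp: fun_eq_iff)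
  have c: "h (f y) = f (h y)" for y
    using h by (simp add: fun_eq_iff)
  have e: "h (f (g y)) = f (g (h y))" for y
    by (metis a c)
  show "(h \<circ> g) x = (g \<circ> h) x"
    by (simp, metis a c e)
qed

section \<open>Localisation at the idempotents\<close>

locale quasi_left_nondegenerate_solution =
  fixes r :: "'a \<times> 'a \<Rightarrow> 'a \<times> 'a"
  assumes solution: "is_solution r"
    and quasi: "quasi_left_nondegenerate r"
    and lam0_lam_comp: "lam0 r (lam r x y) = lam0 r x \<circ> lam0 r y"
    and rho_eq: "rho r y x = lam0 r (lam r x y) (rho r (lam0 r x y) x)"
    and lam0_rho_comp: "lam0 r x \<circ> rho r y = rho r y \<circ> lam0 r x"
begin

abbreviation "L \<equiv> lam r"
abbreviation "R \<equiv> rho r"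
abbreviation "M \<equiv> lam_inv r"
abbreviation "e \<equiv> lam0 r"

lemma braid_1: "L x (L y z) = L (L x y) (L (R y x) z)"
  and braid_2: "L (R (L y z) x) (R z y) = R (L (R y x) z) (L x y)"
  and braid_3: "R z (R y x) = R (R z y) (R (L y z) x)"
proof -
  have eq: "(r_times_id r \<circ> id_times_r r \<circ> r_times_id r) (x, y, z) =
      (id_times_r r \<circ> r_times_id r \<circ> id_times_r r) (x, y, z)"
    using solution by (simp add: is_solution_def)
  note unf = r_times_id_def id_times_r_def lam_def rho_def split_beta
  show "L x (L y z) = L (L x y) (L (R y x) z)"
    using arg_cong [OF eq, of fst] by (simp add: unf)
  show "L (R (L y z) x) (R z y) = R (L (R y x) z) (L x y)"
    using arg_cong [OF eq, of "\<lambda>w. fst (snd w)"] by (simp add: unf)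
  show "R z (R y x) = R (R z y) (R (L y z) x)"
    using arg_cong [OF eq, of "\<lambda>w. snd (snd w)"] by (simp add: unf)
qed

lemma is_relative_inverse_M: "is_relative_inverse (L x) (M x)"
  using quasi is_relative_inverse_rel_inv
  by (auto simp: quasi_left_nondegenerate_def lam_inv_def)

lemma L_M: "L x (M x y) = e x y"
  by (simp add: lam0_def rel_idem_def lam_inv_def)

lemma M_L: "M x (L x y) = e x y"
  and e_L_self: "e x (L x y) = L x y"
  and e_M_self: "e x (M x y) = M x y"
proof -
  have inv: "L x (M x (L x v)) = L x v" "M x (L x (M x v)) = M x v" "L x (M x v) = M x (L x v)"
    for v
    using is_relative_inverse_M [of x] unfolding is_relative_inverse_def fun_eq_iff o_def
    by blast+
  show M_L: "M x (L x y) = e x y" for y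
    by (simp only: inv(3) [symmetric] L_M)
  show "e x (L x y) = L x y"
    using inv(1) [of y] by (simp only: L_M)
  show "e x (M x y) = M x y"
    using inv(2) [of y] by (simp only: M_L)
qed

lemma e_L: "e x (L y z) = L y (e x z)"
  using quasi by (simp add: quasi_left_nondegenerate_def fun_eq_iff)

lemma e_M: "e x (M y z) = M y (e x z)"
  using is_relative_inverse_comm [OF is_relative_inverse_M, of "e x" y] e_L [of x y]
  by (simp add: fun_eq_iff)

lemma e_R: "e x (R y z) = R y (e x z)"
  using lam0_rho_comp [of x y] by (simp add: fun_eq_iff)

lemma e_idem: "e x (e x y) = e x y"
  by (metis L_M e_L_self)

lemma e_commute: "e x (e y z) = e y (e x z)"
  by (metis L_M e_L e_M)

lemma e_left_idem: "e x (e y (e x z)) = e x (e y z)"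
  by (metis e_commute e_idem)

lemma e_of_L: "e (L x y) z = e x (e y z)"
  by (simp add: lam0_lam_comp)

lemma e_of_e: "e (e x y) z = e x (e y z)"
proof -
  have 1: "e (e x y) z = e x (e (M x y) z)" for y z
    by (metis L_M e_of_L)
  have 2: "e x (e y z) = e x (e (e x y) z)" for y z
    by (metis L_M M_L e_L_self e_of_L)
  show ?thesis
    by (metis 1 2 e_idem)
qed

lemma e_of_M: "e (M x y) z = e x (e y z)"
  by (metis L_M e_M_self e_of_L e_of_e)

text \<open>The image of \<open>\<lambda>\<^sub>x\<lambda>\<^sub>y\<close> is the image of \<open>\<lambda>\<^sup>0\<^sub>x\<lambda>\<^sup>0\<^sub>y\<close>. By the first component of the Yang--Baxter
  equation, \<open>\<lambda>\<^sub>x\<lambda>\<^sub>y\<close> is \<open>\<lambda>\<^bsub>\<rho>\<^sub>y(x)\<^esub>\<close> followed by a map that commutes with \<open>\<lambda>\<^sup>0\<^bsub>\<rho>\<^sub>y(x)\<^esub>\<close>, so this image is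
  fixed pointwise by \<open>\<lambda>\<^sup>0\<^bsub>\<rho>\<^sub>y(x)\<^esub>\<close>. That is one half of the equality of idempotents (\<open>ge\<close>); the
  other half (\<open>le\<close>) comes from the assumed formula for \<open>\<rho>\<^sub>y(x)\<close>.\<close>

lemma e_of_R: "e (R y x) z = e x (e y z)"
proof -
  have le: "e (R y x) z = e x (e y (e (R y x) z))"
    by (metis rho_eq e_of_L e_of_e e_idem)
  have image: "e x (e y z) = L x (L y (M y (M x z)))"
    by (metis L_M e_L e_commute)
  have ge: "e (R y x) (e x (e y z)) = e x (e y z)"
    unfolding image by (metis braid_1 e_L e_L_self)
  show ?thesis
    by (metis le ge e_commute)
qed

lemma R_e_left: "R (e x y) x = R y x"
proof -
  have "R y x = e x (e y (R (e x y) x))"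
    by (metis rho_eq e_of_L)
  also have "\<dots> = R (e x y) x"
    by (metis rho_eq e_of_L e_of_e e_idem)
  finally show ?thesis by simp
qed

text \<open>Replacing \<open>y\<close> by \<open>\<lambda>\<^sup>0\<^sub>x(y)\<close> changes neither \<open>\<lambda>\<^sub>x(y)\<close> nor \<open>\<rho>\<^sub>y(x)\<close>, hence not the right-hand side of
  \<open>\<lambda>\<^sub>x\<lambda>\<^sub>y = \<lambda>\<^bsub>\<lambda>\<^sub>x(y)\<^esub>\<lambda>\<^bsub>\<rho>\<^sub>y(x)\<^esub>\<close>. Applying
  \<open>\<lambda>\<^sup>-\<^sub>x\<close> gives \<open>\<lambda>\<^sup>0\<^sub>x\<lambda>\<^sub>y = \<lambda>\<^sup>0\<^sub>x\<lambda>\<^bsub>\<lambda>\<^sup>0\<^sub>x(y)\<^esub>\<close>, and \<open>\<lambda>\<^sup>0\<^sub>x\<close> fixes the image of \<open>\<lambda>\<^bsub>\<lambda>\<^sup>0\<^sub>x(y)\<^esub>\<close>.\<close>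

lemma L_e_left: "L (e x y) z = e x (L y z)"
proof -
  have "L x (L y z) = L x (L (e x y) z)"
    by (metis braid_1 R_e_left e_L e_L_self)
  then have "e x (L y z) = e x (L (e x y) z)"
    by (metis M_L)
  then show ?thesis
    by (metis e_L_self e_of_e e_idem)
qed

lemma M_e_left: "M (e x y) z = e x (M y z)"
proof -
  have "is_relative_inverse (L (e x y)) (\<lambda>z. e x (M y z))"
    unfolding is_relative_inverse_def fun_eq_iff o_def
    by (simp add: L_e_left e_L [symmetric] e_M [symmetric] e_idem e_left_idem L_M M_L e_L_self e_M_self)
  then show ?thesis
    by (simp add: lam_inv_def rel_inv_eqI)
qed

text \<open>By \<open>R_e_left\<close> the subscript of \<open>\<rho>\<^sub>y(x)\<close> absorbs the idempotent of the argument \<open>x\<close>. Moving an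
  outer \<open>\<lambda>\<^sup>0\<^sub>z\<close> into the argument multiplies that idempotent by \<open>\<lambda>\<^sup>0\<^sub>z\<close>, so \<open>\<lambda>\<^sup>0\<^sub>z\<close> is absorbed as well.\<close>

lemma e_R_e_left: "e z (R (e z y) x) = e z (R y x)"
  by (metis R_e_left e_R e_of_e e_commute)

lemma lam0_shelf_op: "e w (shelf_op r x y) = shelf_op r (e w x) (e w y)"
proof -
  have "shelf_op r (e w x) (e w y) = e w (L x (R (e w (M y (e w x))) (e w y)))"
    by (simp add: shelf_op_def L_e_left M_e_left)
  also have "\<dots> = L x (e w (R (e w (M y x)) y))"
    by (simp add: e_L e_R e_M e_idem)
  also have "\<dots> = e w (shelf_op r x y)"
    by (simp add: e_R_e_left e_L shelf_op_def)
  finally show ?thesis by simp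
qed

lemma e_of_shelf_op: "e (shelf_op r x y) z = e x (e y z)"
  by (simp add: shelf_op_def e_of_L e_of_R e_of_M e_idem e_commute e_left_idem)

lemma e_shelf_op_left: "e x (shelf_op r x y) = shelf_op r x y"
  by (simp add: shelf_op_def e_L_self)

lemma e_shelf_op_right: "e y (shelf_op r x y) = shelf_op r x y"
proof -
  have "e y (R u y) = R u y" for u
    by (metis rho_eq e_of_L e_idem)
  then show ?thesis
    by (simp add: shelf_op_def e_L)
qed

text \<open>Every point of the set below has the same idempotent, which acts on the set as the identity;
  so \<open>\<lambda>\<^sub>w\<close> and \<open>\<lambda>\<^sup>-\<^sub>w\<close> are mutually inverse there.\<close>

lemma left_nondegenerate_on_stratum:
  fixes x y z
  defines "E \<equiv> \<lambda>w. e x (e y (e z w))"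
  shows "left_nondegenerate_on {w. E w = w \<and> e w = E} L M R"
proof -
  have comm: "E (L u v) = L u (E v)" "E (M u v) = M u (E v)" "E (R u v) = R u (E v)" for u v
    by (simp_all add: E_def e_L e_M e_R)
  have idem: "E (E v) = E v" for v
    unfolding E_def by (metis e_commute e_idem)
  show ?thesis
    by unfold_locales
      (auto simp: comm idem fun_eq_iff e_of_L e_of_M e_of_R L_M M_L
        intro: braid_1 braid_2 braid_3)
qed

lemma shelf_op_self_distrib:
  "shelf_op r x (shelf_op r y z) = shelf_op r (shelf_op r x y) (shelf_op r x z)"
proof -
  define E where "E = (\<lambda>w. e x (e y (e z w)))"
  define S where "S = {w. E w = w \<and> e w = E}"
  interpret left_nondegenerate_on S L M R
    using left_nondegenerate_on_stratum by (simp add: S_def E_def)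
  have op_eq: "op = shelf_op r"
    by (simp add: fun_eq_iff op_def shelf_op_def)
  have E_op: "E (shelf_op r u v) = shelf_op r (E u) (E v)" for u v
    by (simp add: E_def lam0_shelf_op)
  have "E x \<in> S" "E y \<in> S" "E z \<in> S"
    unfolding S_def E_def fun_eq_iff mem_Collect_eq e_of_e by (metis e_commute e_idem)+
  then have "E (shelf_op r x (shelf_op r y z)) =
      E (shelf_op r (shelf_op r x y) (shelf_op r x z))"
    using op_self_distrib by (simp add: E_op op_eq)
  moreover have "E (shelf_op r x (shelf_op r y z)) = shelf_op r x (shelf_op r y z)"
    unfolding E_def by (metis e_of_shelf_op e_shelf_op_left e_shelf_op_right e_commute e_idem)
  moreover have "E (shelf_op r (shelf_op r x y) (shelf_op r x z)) =
      shelf_op r (shelf_op r x y) (shelf_op r x z)"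
    unfolding E_def by (metis e_of_shelf_op e_shelf_op_left e_shelf_op_right e_commute e_idem)
  ultimately show ?thesis by simp
qed

end

theorem theorem3p8:
  fixes r :: "'a \<times> 'a \<Rightarrow> 'a \<times> 'a"
  assumes "is_solution r"
    and "quasi_left_nondegenerate r"
    and "\<And>x y. lam0 r (lam r x y) = lam0 r x \<circ> lam0 r y"
    and "\<And>x y. rho r y x = lam0 r (lam r x y) (rho r (lam0 r x y) x)"
    and "\<And>x y. lam0 r x \<circ> rho r y = rho r y \<circ> lam0 r x"
  shows "is_shelf (shelf_op r)"
proof -
  interpret quasi_left_nondegenerate_solution r
    using assms by unfold_locales
  show ?thesis
    unfolding is_shelf_def using shelf_op_self_distrib by blast
qed

end
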